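(* Let $\nu\geq 2$ be an integer and let $P(x)=c_{\nu}x^{\nu}+c_{\nu-1}x^{\nu-1}+\cdots+c_1x\in\mathbb{Z}[x]$ have non-zero discriminant. Then for every $\Lambda>0$, $\limsup_{Q\to\infty}\mathcal{S}_{\mathcal{F}_{Q,P}}(\Lambda)$ is finite, and moreover \[\limsup_{Q\to\infty}\mathcal{S}_{\mathcal{F}_{Q,P}}(\Lambda)\ll\int_{0}^{\Lambda}\frac{1}{\lambda^{2}}\sum_{1\leq m<\frac{2\lambda}{\beta_{P}}}h(m)\log\left(\frac{2\lambda}{m\beta_{P}} \right) d\lambda,\] where $\beta_{P}=\prod_p \left(1-\frac{f_{P}(p)}{p^2}\right)$ and $h(m)=\sum_{\substack{n,\delta, d_1,d_2\geq 1\\ n\delta d_1d_2=m}}n f_P(d_1)f_P(d_2)$.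
   Context: For a positive integer $m$, $f_P(m)=\#\{1\le d\le m: P(d)\equiv0\pmod m\}$. $\mathcal{F}_{Q,P}=\{a/q: 1\leq a\leq q\leq Q,\ \gcd(P(a),q)=1\}$ and $\mathcal{N}_{Q,P}=\#\mathcal{F}_{Q,P}$. For $\Lambda>0$, the pair correlation quantity is $\mathcal{S}_{\mathcal{F}_{Q,P}}(\Lambda)=\frac{1}{\mathcal{N}_{Q,P}}\#\{(\gamma_1,\gamma_2)\in\mathcal{F}_{Q,P}^2:\gamma_1\ne\gamma_2,\ \gamma_1-\gamma_2\in\frac{1}{\mathcal{N}_{Q,P}}(0,\Lambda)+\mathbb{Z}\}$. *)

theory Defs
  imports
    "HOL-Analysis.Analysis"
    "HOL-Number_Theory.Cong"
    "HOL-Computational_Algebra.Primes"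
    "Subresultants.Resultant_Prelim"
begin

text \<open>
  Over the integers the division by the leading coefficient is exact: the first column of the
  Sylvester matrix of \<open>P\<close> and its derivative is divisible by it.
\<close>
definition discriminant :: "int poly \<Rightarrow> int" where
  "discriminant P =
     (-1) ^ (degree P * (degree P - 1) div 2) * (resultant P (pderiv P) div lead_coeff P)"

definition root_count :: "int poly \<Rightarrow> nat \<Rightarrow> nat" where
  "root_count P m = card {d::nat. 1 \<le> d \<and> d \<le> m \<and> [poly P (int d) = 0] (mod int m)}"

definition farey_set :: "int poly \<Rightarrow> nat \<Rightarrow> real set" where
  "farey_set P Q =
     {real a / real q | a q :: nat. 1 \<le> a \<and> a \<le> q \<and> q \<le> Q \<and> gcd (poly P (int a)) (int q) = 1}"

definition farey_card :: "int poly \<Rightarrow> nat \<Rightarrow> nat" where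
  "farey_card P Q = card (farey_set P Q)"

definition pair_correlation :: "int poly \<Rightarrow> nat \<Rightarrow> real \<Rightarrow> real" where
  "pair_correlation P Q \<Lambda> =
     1 / real (farey_card P Q) *
     real (card {(\<gamma>\<^sub>1, \<gamma>\<^sub>2). \<gamma>\<^sub>1 \<in> farey_set P Q \<and> \<gamma>\<^sub>2 \<in> farey_set P Q \<and> \<gamma>\<^sub>1 \<noteq> \<gamma>\<^sub>2 \<and>
       (\<exists>t\<in>{0<..<\<Lambda>}. \<exists>k::int. \<gamma>\<^sub>1 - \<gamma>\<^sub>2 = 1 / real (farey_card P Q) * t + of_int k)})"

definition beta_const :: "int poly \<Rightarrow> real" where
  "beta_const P = (\<Prod>p::nat. if prime p then 1 - real (root_count P p) / (real p)\<^sup>2 else 1)"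

definition h_weight :: "int poly \<Rightarrow> nat \<Rightarrow> nat" where
  "h_weight P m = (\<Sum>(n, \<delta>, d\<^sub>1, d\<^sub>2) \<in> {(n, \<delta>, d\<^sub>1, d\<^sub>2). n \<ge> 1 \<and> \<delta> \<ge> 1 \<and> d\<^sub>1 \<ge> 1 \<and> d\<^sub>2 \<ge> 1 \<and>
              n * \<delta> * d\<^sub>1 * d\<^sub>2 = m}. n * root_count P d\<^sub>1 * root_count P d\<^sub>2)"

end

theory Submission
  imports Defs "HOL-Real_Asymp.Real_Asymp"
begin

text \<open>
  Since \<open>P 0 = 0\<close>, the condition \<open>gcd (P a) q = 1\<close> makes \<open>a / q\<close> reduced, so the number \<open>N\<close> of
  fractions counts pairs \<open>(a, q)\<close>; sieving by the primes up to \<open>z\<close> and letting \<open>z\<close> grow gives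
  \<open>liminf N / Q\<^sup>2 \<ge> \<beta> / 2\<close>. Only this lower bound on \<open>N\<close> is used.

  A pair of fractions with denominators \<open>q, r \<le> Q\<close> at distance less than \<open>T / Q\<^sup>2\<close> modulo 1, where
  \<open>T\<close> tends to \<open>U = 2\<Lambda> / \<beta>\<close>, has distance \<open>k / (q r)\<close> with an integer \<open>1 \<le> k < T\<close>. This forces
  \<open>q, r > k Q / T\<close> and \<open>gcd q r dvd k\<close>, and given \<open>q, r, k\<close> there are at most \<open>gcd q r\<close> such pairs,
  whether or not the fractions are reduced. Hence the limsup is at most
  \<open>2 / \<beta>\<close> times the sum over \<open>k < U\<close> and \<open>g dvd k\<close> of \<open>(1 - k / U)\<^sup>2 / g\<close>.

  On the other side, term by term integration turns the integral into \<open>2 / \<beta>\<close> times the sum over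
  \<open>m < U\<close> of \<open>h(m) / m * (1 - y + y ln y)\<close> with \<open>y = m / U\<close>. As \<open>h(m)\<close> is at least the divisor sum
  of \<open>m\<close> and \<open>1 - y + y ln y \<ge> (1 - y)\<^sup>2 / 2\<close>, the constant \<open>2\<close> works.
\<close>

section \<open>Polynomial values and residue classes\<close>

lemma diff_dvd_poly_diff:
  fixes P :: "'a::comm_ring_1 poly"
  shows "x - y dvd poly P x - poly P y"
proof -
  have "poly P x = poly ([:- y, 1:] * synthetic_div P y + [:poly P y:]) x"
    by (simp only: synthetic_div_correct')
  also have "\<dots> = (x - y) * poly (synthetic_div P y) x + poly P y"
    by (simp add: algebra_simps)
  finally show ?thesis by simp
qed

lemma cong_poly:
  fixes P :: "'a::unique_euclidean_ring poly"
  assumes "[x = y] (mod m)"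
  shows "[poly P x = poly P y] (mod m)"
  using assms diff_dvd_poly_diff[of x y P] unfolding cong_iff_dvd_diff by (rule dvd_trans)

lemma card_incongruent_roots_le_degree:
  fixes P :: "'a::idom poly"
  assumes "prime_elem p" "\<not> [:p:] dvd P" "finite A"
    and "\<And>x. x \<in> A \<Longrightarrow> p dvd poly P x"
    and "\<And>x y. x \<in> A \<Longrightarrow> y \<in> A \<Longrightarrow> p dvd x - y \<Longrightarrow> x = y"
  shows "card A \<le> degree P"
  using assms(3,2,4,5)
proof (induction A arbitrary: P rule: finite_induct)
  case (insert a A)
  define S where "S = synthetic_div P a"
  have P_eq: "P = [:- a, 1:] * S + [:poly P a:]"
    unfolding S_def by (rule synthetic_div_correct'[symmetric])
  have dvd_const: "[:p:] dvd [:poly P a:]"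
    using insert.prems(2)[of a] by simp
  have "\<not> [:p:] dvd S"
  proof
    assume "[:p:] dvd S"
    then have "[:p:] dvd [:- a, 1:] * S + [:poly P a:]" using dvd_const by (intro dvd_add dvd_mult)
    then show False using insert.prems(1) P_eq by simp
  qed
  moreover have "p dvd poly S x" if "x \<in> A" for x
  proof -
    have "poly P x = (x - a) * poly S x + poly P a"
      by (subst P_eq) (simp add: algebra_simps)
    moreover have "p dvd poly P x" "p dvd poly P a" using insert.prems(2) that by auto
    ultimately have "p dvd (x - a) * poly S x" using dvd_add_left_iff by metis
    moreover have "\<not> p dvd x - a" using insert.prems(3)[of x a] insert.hyps(2) that by auto
    ultimately show ?thesis using assms(1) by (simp add: prime_elem_dvd_mult_iff)
  qed
  ultimately have "card A \<le> degree S" using insert.IH insert.prems(3) by blast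
  moreover have "degree S = degree P - 1" unfolding S_def by (rule degree_synthetic_div)
  moreover have "degree P \<noteq> 0"
  proof
    assume "degree P = 0"
    then have "P = [:poly P a:]" by (auto elim: degree_eq_zeroE)
    then show False using dvd_const insert.prems(1) by metis
  qed
  ultimately show ?case using insert.hyps by simp
qed simp

lemma card_Collect_eq_sum_of_bool: "finite A \<Longrightarrow> card {d \<in> A. R d} = (\<Sum>d\<in>A. of_bool (R d))"
  by (simp add: Int_def)

lemma card_Collect_atLeastAtMost_eq_lessThan:
  fixes m :: nat
  assumes "R m \<longleftrightarrow> R 0"
  shows "card {d \<in> {1..m}. R d} = card {d \<in> {..<m}. R d}"
proof -
  let ?f = "\<lambda>d. of_bool (R d) :: nat"
  have "?f 0 + sum ?f {1..m} = sum ?f {..<Suc m}"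
    by (simp only: One_nat_def sum.atLeast1_atMost_eq sum.lessThan_Suc_shift)
  also have "\<dots> = sum ?f {..<m} + ?f 0"
    by (simp only: sum.lessThan_Suc assms)
  finally have "sum ?f {1..m} = sum ?f {..<m}"
    by (simp del: sum_of_bool_eq)
  then show ?thesis
    by (simp only: card_Collect_eq_sum_of_bool finite_atLeastAtMost finite_lessThan)
qed

lemma card_Collect_periodic:
  fixes m :: nat
  assumes "\<And>d. R (d + m) \<longleftrightarrow> R d"
  shows "card {d \<in> {1..n * m}. R d} = n * card {d \<in> {1..m}. R d}"
proof -
  let ?f = "\<lambda>i. of_bool (R (Suc i)) :: nat"
  have card_eq_sum: "card {d \<in> {1..l}. R d} = sum ?f {..<l}" for l
    by (simp only: One_nat_def card_Collect_eq_sum_of_bool finite_atLeastAtMost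
        sum.atLeast1_atMost_eq)
  have "R (d + k * m) \<longleftrightarrow> R d" for d k
    using assms[of "d + _ * m"] by (induction k) (simp_all add: ac_simps)
  then have "sum ?f {k * m..<k * m + m} = sum ?f {..<m}" for k
    using sum.shift_bounds_nat_ivl[of ?f 0 "k * m" m]
    by (simp add: lessThan_atLeast0 add.commute del: sum_of_bool_eq flip: add_Suc)
  then show ?thesis
    unfolding card_eq_sum sum.nat_group[symmetric] by simp
qed

lemma bij_betw_mod_pair:
  fixes m n :: nat
  assumes "coprime m n" "m > 0" "n > 0"
  shows "bij_betw (\<lambda>d. (d mod m, d mod n)) {..<m * n} ({..<m} \<times> {..<n})" (is "bij_betw ?f ?A ?B")
proof -
  have inj: "inj_on ?f ?A"
  proof (rule inj_onI)
    fix x y assume xy: "x \<in> ?A" "y \<in> ?A" "?f x = ?f y"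
    then have "[x = y] (mod m * n)"
      using assms(1) by (intro coprime_cong_mult_nat) (auto simp: cong_def)
    then show "x = y" using xy by (intro cong_less_modulus_unique_nat[of x y]) auto
  qed
  moreover have "?f ` ?A = ?B"
    using assms inj by (intro card_subset_eq) (auto simp: card_image)
  ultimately show ?thesis by (rule bij_betw_imageI)
qed

lemma card_residue_class_le: "card {a \<in> {1..n * s}. [a = c] (mod s)} \<le> n"
proof -
  have "card {a \<in> {1..s}. [a = c] (mod s)} = card {a \<in> {..<s}. [a = c] (mod s)}"
    by (rule card_Collect_atLeastAtMost_eq_lessThan) (simp add: cong_def)
  moreover have "x = y" if "x < s" "y < s" "[x = c] (mod s)" "[y = c] (mod s)" for x y
    using that by (meson cong_less_modulus_unique_nat cong_sym cong_trans)
  then have "card {a \<in> {..<s}. [a = c] (mod s)} \<le> 1"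
    by (simp add: card_le_Suc0_iff_eq)
  moreover have "card {a \<in> {1..n * s}. [a = c] (mod s)} = n * card {a \<in> {1..s}. [a = c] (mod s)}"
    by (rule card_Collect_periodic) (simp add: cong_def)
  ultimately show ?thesis by (metis mult_le_mono2 mult_1_right)
qed

lemma tendsto_of_nat_div_over:
  assumes "D > 0"
  shows "(\<lambda>Q. real (Q div D) / real Q) \<longlonglongrightarrow> 1 / real D"
proof -
  have "(\<lambda>Q. real_of_int \<lfloor>real Q / real D\<rfloor> / real Q) \<longlonglongrightarrow> 1 / real D"
    using assms by real_asymp (simp add: inverse_eq_divide)
  then show ?thesis by (simp add: floor_divide_of_nat_eq)
qed

section \<open>Roots modulo \<open>m\<close>\<close>

lemma root_count_altdef: "root_count P m = card {d \<in> {1..m}. int m dvd poly P (int d)}"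
  unfolding root_count_def by (rule arg_cong[where f = card]) (auto simp: cong_0_iff)

lemma dvd_poly_cong_iff:
  assumes "[x = y] (mod m)"
  shows "int m dvd poly P (int x) \<longleftrightarrow> int m dvd poly P (int y)"
  using assms by (intro cong_dvd_iff cong_poly) (simp add: cong_int_iff)

lemma root_count_eq_card_lessThan: "root_count P m = card {d \<in> {..<m}. int m dvd poly P (int d)}"
  unfolding root_count_altdef
  by (intro card_Collect_atLeastAtMost_eq_lessThan dvd_poly_cong_iff) (simp add: cong_def)

lemma root_count_le: "root_count P m \<le> m"
proof -
  have "root_count P m \<le> card {..<m}"
    unfolding root_count_eq_card_lessThan by (rule card_mono) auto
  then show ?thesis by simp
qed

lemma root_count_1 [simp]: "root_count P (Suc 0) = 1"
  by (simp add: root_count_eq_card_lessThan)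

lemma root_count_mult:
  assumes "coprime m n" "m > 0" "n > 0"
  shows "root_count P (m * n) = root_count P m * root_count P n"
proof -
  let ?R = "\<lambda>m. {d \<in> {..<m}. int m dvd poly P (int d)}"
  have dvd_poly_mod: "int k dvd poly P (int (d mod k)) \<longleftrightarrow> int k dvd poly P (int d)" for k d
    by (rule dvd_poly_cong_iff) (simp add: cong_def)
  have "int m dvd poly P (int (d mod m)) \<and> int n dvd poly P (int (d mod n)) \<longleftrightarrow>
      int (m * n) dvd poly P (int d)" for d
    using assms(1) unfolding dvd_poly_mod of_nat_mult
    by (meson coprime_int_iff divides_mult dvd_mult_left dvd_mult_right)
  then have "bij_betw (\<lambda>d. (d mod m, d mod n)) (?R (m * n))
      {x \<in> {..<m} \<times> {..<n}. int m dvd poly P (int (fst x)) \<and> int n dvd poly P (int (snd x))}"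
    by (intro bij_betw_Collect bij_betw_mod_pair assms) simp
  also have "{x \<in> {..<m} \<times> {..<n}.
      int m dvd poly P (int (fst x)) \<and> int n dvd poly P (int (snd x))} = ?R m \<times> ?R n"
    by auto
  finally have "card (?R (m * n)) = card (?R m) * card (?R n)"
    by (simp add: bij_betw_same_card card_cartesian_product)
  then show ?thesis by (simp add: root_count_eq_card_lessThan)
qed

lemma root_count_prime_le_degree:
  assumes "prime p" "\<not> [:int p:] dvd P"
  shows "root_count P p \<le> degree P"
proof -
  let ?R = "{d \<in> {..<p}. int p dvd poly P (int d)}"
  have "x = y" if "x < p" "y < p" "int p dvd int x - int y" for x y
    using that by (metis cong_iff_dvd_diff cong_int_iff cong_less_modulus_unique_nat)
  then have "card (int ` ?R) \<le> degree P"
    using assms by (intro card_incongruent_roots_le_degree[of "int p"]) auto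
  then show ?thesis by (simp add: root_count_eq_card_lessThan card_image)
qed

definition root_density :: "int poly \<Rightarrow> nat \<Rightarrow> real" where
  "root_density P m = real (root_count P m) / (real m)\<^sup>2"

lemma root_density_nonneg: "root_density P m \<ge> 0"
  by (simp add: root_density_def)

lemma root_density_1 [simp]: "root_density P (Suc 0) = 1"
  by (simp add: root_density_def)

lemma root_density_mult:
  "coprime m n \<Longrightarrow> m > 0 \<Longrightarrow> n > 0 \<Longrightarrow> root_density P (m * n) = root_density P m * root_density P n"
  by (simp add: root_density_def root_count_mult power_mult_distrib)

lemma root_density_less_1:
  assumes "m > 1"
  shows "root_density P m < 1"
proof -
  have "m < m\<^sup>2" using assms by (simp add: power2_eq_square)
  then have "root_count P m < m\<^sup>2" using root_count_le[of P m] by linarith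
  then have "real (root_count P m) < (real m)\<^sup>2"
    by (metis of_nat_less_iff of_nat_power)
  then show ?thesis using assms by (simp add: root_density_def)
qed

section \<open>The Euler product\<close>

definition prime_root_density :: "int poly \<Rightarrow> nat \<Rightarrow> real" where
  "prime_root_density P p = (if prime p then root_density P p else 0)"

lemma beta_const_altdef: "beta_const P = (\<Prod>p. 1 - prime_root_density P p)"
  unfolding beta_const_def
  by (intro arg_cong[where f = prodinf]) (auto simp: prime_root_density_def root_density_def)

lemma prime_root_density_nonneg: "0 \<le> prime_root_density P p"
  by (simp add: prime_root_density_def root_density_nonneg)

lemma prime_root_density_less_1: "prime_root_density P p < 1"
  using root_density_less_1[OF prime_gt_1_nat] by (simp add: prime_root_density_def)

lemma summable_prime_root_density:
  assumes "P \<noteq> 0"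
  shows "summable (prime_root_density P)"
proof (rule summable_comparison_test_ev)
  show "summable (\<lambda>p. real (degree P) * inverse ((real p)\<^sup>2))"
    by (intro summable_mult inverse_power_summable) simp
  show "\<forall>\<^sub>F p in sequentially.
      norm (prime_root_density P p) \<le> real (degree P) * inverse ((real p)\<^sup>2)"
    using eventually_gt_at_top[of "nat \<bar>lead_coeff P\<bar>"]
  proof eventually_elim
    case (elim p)
    have "\<not> int p dvd lead_coeff P"
      using elim assms dvd_imp_le_int[of "lead_coeff P" "int p"] by auto
    then have "\<not> [:int p:] dvd P" by (auto simp: const_poly_dvd_iff)
    then show ?case
      by (auto simp: prime_root_density_def root_density_def root_count_prime_le_degree
          divide_inverse intro!: mult_right_mono)
  qed
qed

lemma convergent_prod_prime_root_density:
  assumes "P \<noteq> 0"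
  shows "convergent_prod (\<lambda>p. 1 - prime_root_density P p)"
  using summable_prime_root_density[OF assms]
  by (intro abs_convergent_prod_imp_convergent_prod)
    (simp add: abs_convergent_prod_conv_summable prime_root_density_nonneg)

lemma beta_const_pos:
  assumes "P \<noteq> 0"
  shows "beta_const P > 0"
  unfolding beta_const_altdef
  using prime_root_density_less_1
  by (intro less_0_prodinf convergent_prod_prime_root_density assms) simp

lemma beta_const_le_prod:
  assumes "P \<noteq> 0"
  shows "beta_const P \<le> (\<Prod>p | prime p \<and> p \<le> z. 1 - root_density P p)"
proof -
  have "beta_const P \<le> (\<Prod>p<Suc z. 1 - prime_root_density P p)"
    unfolding beta_const_altdef
    using convergent_prod_has_prod[OF convergent_prod_prime_root_density[OF assms]]
    by (rule prod_ge_prodinf)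
      (simp_all add: prime_root_density_nonneg prime_root_density_less_1 less_imp_le)
  also have "\<dots> = (\<Prod>p | prime p \<and> p \<le> z. 1 - root_density P p)"
    by (rule prod.mono_neutral_cong_right) (auto simp: prime_root_density_def)
  finally show ?thesis .
qed

section \<open>Sieving by primes\<close>

lemma tendsto_sieved_density:
  fixes X :: "nat \<Rightarrow> 'a set" and G :: "'a \<Rightarrow> nat" and V w :: "nat \<Rightarrow> real"
  assumes finite: "\<And>n. finite (X n)"
    and density: "\<And>D. D > 0 \<Longrightarrow> (\<lambda>n. real (card {x \<in> X n. D dvd G x}) / V n) \<longlonglongrightarrow> c * w D"
    and mult: "\<And>D E. coprime D E \<Longrightarrow> D > 0 \<Longrightarrow> E > 0 \<Longrightarrow> w (D * E) = w D * w E"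
    and S: "finite S" "\<And>p. p \<in> S \<Longrightarrow> prime p"
    and D: "D > 0" "\<And>p. p \<in> S \<Longrightarrow> coprime p D"
  shows "(\<lambda>n. real (card {x \<in> X n. D dvd G x \<and> (\<forall>p\<in>S. \<not> p dvd G x)}) / V n) \<longlonglongrightarrow>
    c * w D * (\<Prod>p\<in>S. 1 - w p)"
  using S D
proof (induction S arbitrary: D rule: finite_induct)
  case empty
  then show ?case using density by simp
next
  case (insert p S)
  define Y where "Y = (\<lambda>S D n. {x \<in> X n. D dvd G x \<and> (\<forall>p\<in>S. \<not> p dvd G x)})"
  have p: "coprime p D" "p > 0" using insert.prems by (auto simp: prime_gt_0_nat)
  have coprime: "coprime r (p * D)" if "r \<in> S" for r
    using that insert.hyps(2) insert.prems
    by (metis coprime_mult_right_iff insert_iff primes_coprime)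
  have "p * D dvd x \<longleftrightarrow> p dvd x \<and> D dvd x" for x
    using p(1) by (meson divides_mult dvd_mult_left dvd_mult_right)
  then have split: "Y S D n = Y (insert p S) D n \<union> Y S (p * D) n"
    "Y (insert p S) D n \<inter> Y S (p * D) n = {}" for n
    by (auto simp: Y_def)
  have "finite (Y S D n)" for S D n by (simp add: Y_def finite)
  then have "card (Y S D n) = card (Y (insert p S) D n) + card (Y S (p * D) n)" for n
    by (simp only: split card_Un_disjoint)
  then have "real (card (Y (insert p S) D n)) / V n =
      real (card (Y S D n)) / V n - real (card (Y S (p * D) n)) / V n" for n
    by (simp add: add_divide_distrib)
  moreover have "(\<lambda>n. real (card (Y S D n)) / V n - real (card (Y S (p * D) n)) / V n) \<longlonglongrightarrow>
      c * w D * (\<Prod>p\<in>S. 1 - w p) - c * w (p * D) * (\<Prod>p\<in>S. 1 - w p)"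
    unfolding Y_def by (intro tendsto_diff insert.IH) (use insert.prems p coprime in auto)
  moreover have "c * w D * (\<Prod>p\<in>S. 1 - w p) - c * w (p * D) * (\<Prod>p\<in>S. 1 - w p) =
      c * w D * (\<Prod>p\<in>insert p S. 1 - w p)"
    using insert.hyps mult[OF p insert.prems(2)] by (simp add: algebra_simps)
  ultimately show ?case by (simp add: Y_def)
qed

definition fraction_pairs :: "nat \<Rightarrow> (nat \<times> nat) set" where
  "fraction_pairs Q = {(a, q). 1 \<le> a \<and> a \<le> q \<and> q \<le> Q}"

lemma finite_fraction_pairs [simp]: "finite (fraction_pairs Q)"
  by (rule finite_subset[of _ "{1..Q} \<times> {1..Q}"]) (auto simp: fraction_pairs_def)

definition value_gcd :: "int poly \<Rightarrow> nat \<times> nat \<Rightarrow> nat" where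
  "value_gcd P = (\<lambda>(a, q). nat (gcd (poly P (int a)) (int q)))"

lemma dvd_value_gcd_iff: "D dvd value_gcd P (a, q) \<longleftrightarrow> int D dvd poly P (int a) \<and> D dvd q"
  by (simp add: value_gcd_def flip: int_dvd_int_iff)

lemma card_dvd_value_gcd:
  assumes "D > 0"
  shows "2 * card {x \<in> fraction_pairs Q. D dvd value_gcd P x} =
    root_count P D * ((Q div D) * (Q div D + 1))"
proof -
  let ?A = "{x \<in> fraction_pairs Q. D dvd value_gcd P x}"
  let ?T = "SIGMA j:{1..Q div D}. {a \<in> {1..j * D}. int D dvd poly P (int a)}"
  have "bij_betw (\<lambda>(j, a). (a, j * D)) ?T ?A"
  proof (rule bij_betw_byWitness[where f' = "\<lambda>(a, q). (q div D, a)"])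
    show "(\<lambda>(j, a). (a, j * D)) ` ?T \<subseteq> ?A"
      using assms by (auto simp: fraction_pairs_def dvd_value_gcd_iff less_eq_div_iff_mult_less_eq)
    show "(\<lambda>(a, q). (q div D, a)) ` ?A \<subseteq> ?T"
      using assms by (auto simp: fraction_pairs_def dvd_value_gcd_iff div_le_mono Suc_le_eq
          div_greater_zero_iff intro!: dvd_imp_le[of D])
  qed (use assms in \<open>auto simp: dvd_value_gcd_iff\<close>)
  then have "card ?A = card ?T" by (simp add: bij_betw_same_card)
  also have "\<dots> = (\<Sum>j\<in>{1..Q div D}. card {a \<in> {1..j * D}. int D dvd poly P (int a)})"
    by (rule card_SigmaI) auto
  also have "\<dots> = (\<Sum>j\<in>{1..Q div D}. j * root_count P D)"
    unfolding root_count_altdef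
    by (intro sum.cong card_Collect_periodic dvd_poly_cong_iff) (simp_all add: cong_def)
  finally have "2 * card ?A = root_count P D * (2 * (\<Sum>j\<in>{1..Q div D}. j))"
    by (simp flip: sum_distrib_right)
  then show ?thesis using double_gauss_sum_from_Suc_0[where 'a = nat, of "Q div D"] by simp
qed

lemma tendsto_card_dvd_value_gcd:
  assumes "D > 0"
  shows "(\<lambda>Q. real (card {x \<in> fraction_pairs Q. D dvd value_gcd P x}) / (real Q)\<^sup>2) \<longlonglongrightarrow>
    1 / 2 * root_density P D"
proof -
  let ?r = "\<lambda>Q. real (Q div D) / real Q"
  have "real (card {x \<in> fraction_pairs Q. D dvd value_gcd P x}) / (real Q)\<^sup>2 =
      real (root_count P D) / 2 * (?r Q * (?r Q + 1 / real Q))" for Q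
  proof -
    have "real (card {x \<in> fraction_pairs Q. D dvd value_gcd P x}) =
        real (root_count P D) / 2 * (real (Q div D) * (real (Q div D) + 1))"
      using arg_cong[OF card_dvd_value_gcd[OF assms, where Q = Q and P = P], of real]
      by (simp add: distrib_left)
    then show ?thesis
      by (simp only:) (simp add: power2_eq_square add_divide_distrib[symmetric])
  qed
  moreover have "(\<lambda>Q. real (root_count P D) / 2 * (?r Q * (?r Q + 1 / real Q))) \<longlonglongrightarrow>
      real (root_count P D) / 2 * (1 / real D * (1 / real D + 0))"
    by (intro tendsto_intros tendsto_of_nat_div_over assms lim_1_over_n)
  ultimately show ?thesis by (simp add: root_density_def power2_eq_square)
qed

lemma card_dvd_value_gcd_le:
  assumes "D > 0"
  shows "real (card {x \<in> fraction_pairs Q. D dvd value_gcd P x}) \<le> root_density P D * (real Q)\<^sup>2"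
proof -
  let ?m = "Q div D" and ?A = "{x \<in> fraction_pairs Q. D dvd value_gcd P x}"
  have "2 * card ?A \<le> root_count P D * (2 * ?m\<^sup>2)"
    unfolding card_dvd_value_gcd[OF assms]
    by (intro mult_left_mono) (cases ?m, auto simp: power2_eq_square)
  then have "card ?A \<le> root_count P D * ?m\<^sup>2" by simp
  then have "real (card ?A) \<le> real (root_count P D) * (real ?m)\<^sup>2"
    by (metis of_nat_le_iff of_nat_mult of_nat_power)
  also have "\<dots> \<le> real (root_count P D) * (real Q / real D)\<^sup>2"
    by (intro mult_left_mono power_mono of_nat_div_le_of_nat) auto
  finally show ?thesis by (simp add: root_density_def power_divide)
qed

section \<open>The number of fractions\<close>

lemma inj_on_coprime_fraction:
  "inj_on (\<lambda>(a, q). of_nat a / of_nat q :: 'a::field_char_0) {(a, q). coprime a q \<and> q > 0}"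
proof (rule inj_onI, clarify)
  fix a q b r :: nat
  assume cop: "coprime a q" "coprime b r" and "q > 0" "r > 0"
    and "of_nat a / of_nat q = (of_nat b / of_nat r :: 'a)"
  then have "of_nat (a * r) = (of_nat (b * q) :: 'a)" by (simp add: frac_eq_eq)
  then have "a * r = b * q" by (simp only: of_nat_eq_iff)
  then show "a = b \<and> q = r"
    using coprime_crossproduct_nat[of a q b r] cop by (simp add: mult.commute)
qed

lemma coprime_if_value_gcd_1:
  assumes "coeff P 0 = 0" "value_gcd P (a, q) = 1"
  shows "coprime a q"
proof -
  have "int a dvd poly P (int a)"
    using diff_dvd_poly_diff[of "int a" 0 P] assms(1) by (simp add: poly_0_coeff_0)
  moreover have "gcd (poly P (int a)) (int q) = 1"
    using assms(2) by (simp add: value_gcd_def)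
  ultimately have "coprime (int a) (int q)"
    by (meson coprime_divisors coprime_iff_gcd_eq_1 dvd_refl)
  then show ?thesis by simp
qed

lemma farey_set_eq:
  "farey_set P Q = (\<lambda>(a, q). real a / real q) ` {x \<in> fraction_pairs Q. value_gcd P x = 1}"
  unfolding farey_set_def fraction_pairs_def value_gcd_def by (force simp: image_iff nat_eq_iff)

lemma finite_farey_set [simp]: "finite (farey_set P Q)"
  by (simp add: farey_set_eq)

lemma farey_card_eq:
  assumes "coeff P 0 = 0"
  shows "farey_card P Q = card {x \<in> fraction_pairs Q. value_gcd P x = 1}"
proof -
  have "inj_on (\<lambda>(a, q). real a / real q) {x \<in> fraction_pairs Q. value_gcd P x = 1}"
    by (rule inj_on_subset[OF inj_on_coprime_fraction])
      (use coprime_if_value_gcd_1[OF assms] in \<open>auto simp: fraction_pairs_def\<close>)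
  then show ?thesis by (simp add: farey_card_def farey_set_eq card_image)
qed

definition sieved_pairs :: "int poly \<Rightarrow> nat \<Rightarrow> nat \<Rightarrow> (nat \<times> nat) set" where
  "sieved_pairs P z Q = {x \<in> fraction_pairs Q. \<forall>p. prime p \<and> p \<le> z \<longrightarrow> \<not> p dvd value_gcd P x}"

lemma tendsto_card_sieved_pairs:
  "(\<lambda>Q. real (card (sieved_pairs P z Q)) / (real Q)\<^sup>2) \<longlonglongrightarrow>
    (\<Prod>p | prime p \<and> p \<le> z. 1 - root_density P p) / 2"
proof -
  have "(\<lambda>Q. real (card {x \<in> fraction_pairs Q. 1 dvd value_gcd P x \<and>
        (\<forall>p\<in>{p. prime p \<and> p \<le> z}. \<not> p dvd value_gcd P x)}) / (real Q)\<^sup>2) \<longlonglongrightarrow>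
      1 / 2 * root_density P 1 * (\<Prod>p | prime p \<and> p \<le> z. 1 - root_density P p)"
    by (rule tendsto_sieved_density)
      (auto intro: tendsto_card_dvd_value_gcd[simplified] root_density_mult)
  then show ?thesis by (simp add: sieved_pairs_def Ball_def)
qed

lemma sieved_pairs_subset:
  "sieved_pairs P z Q \<subseteq> {x \<in> fraction_pairs Q. value_gcd P x = 1} \<union>
    (\<Union>p\<in>{p \<in> {z<..Q}. prime p}. {x \<in> fraction_pairs Q. p dvd value_gcd P x})"
proof (rule subrelI)
  fix a q
  assume aq: "(a, q) \<in> sieved_pairs P z Q"
  show "(a, q) \<in> {x \<in> fraction_pairs Q. value_gcd P x = 1} \<union>
    (\<Union>p\<in>{p \<in> {z<..Q}. prime p}. {x \<in> fraction_pairs Q. p dvd value_gcd P x})"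
  proof (cases "value_gcd P (a, q) = 1")
    case False
    then obtain p where p: "prime p" "p dvd value_gcd P (a, q)"
      using prime_factor_nat by blast
    have "z < p" using aq p by (auto simp: sieved_pairs_def not_le[symmetric])
    moreover have "p \<le> Q"
      using aq p(2)
      by (auto simp: sieved_pairs_def dvd_value_gcd_iff fraction_pairs_def dest!: dvd_imp_le)
    ultimately show ?thesis using aq p by (auto simp: sieved_pairs_def)
  qed (use aq in \<open>auto simp: sieved_pairs_def\<close>)
qed

lemma card_sieved_pairs_le_farey_card:
  assumes "coeff P 0 = 0"
  shows "real (card (sieved_pairs P z Q)) \<le>
    real (farey_card P Q) + (\<Sum>p\<in>{z<..Q}. prime_root_density P p) * (real Q)\<^sup>2"
proof -
  let ?E = "{x \<in> fraction_pairs Q. value_gcd P x = 1}"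
  let ?D = "\<lambda>p. {x \<in> fraction_pairs Q. p dvd value_gcd P x}"
  let ?I = "{p \<in> {z<..Q}. prime p}"
  have "card (sieved_pairs P z Q) \<le> card (?E \<union> (\<Union>p\<in>?I. ?D p))"
    by (intro card_mono sieved_pairs_subset) auto
  also have "\<dots> \<le> card ?E + card (\<Union>p\<in>?I. ?D p)" by (rule card_Un_le)
  also have "card (\<Union>p\<in>?I. ?D p) \<le> (\<Sum>p\<in>?I. card (?D p))"
    by (rule card_UN_le) simp
  finally have "real (card (sieved_pairs P z Q)) \<le> real (farey_card P Q + (\<Sum>p\<in>?I. card (?D p)))"
    by (simp only: of_nat_le_iff farey_card_eq[OF assms])
  also have "\<dots> = real (farey_card P Q) + (\<Sum>p\<in>?I. real (card (?D p)))" by simp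
  also have "(\<Sum>p\<in>?I. real (card (?D p))) \<le> (\<Sum>p\<in>?I. root_density P p * (real Q)\<^sup>2)"
    by (intro sum_mono card_dvd_value_gcd_le) auto
  also have "\<dots> = (\<Sum>p\<in>{z<..Q}. prime_root_density P p) * (real Q)\<^sup>2"
    unfolding sum_distrib_right
    by (rule sum.mono_neutral_cong_left) (auto simp: prime_root_density_def)
  finally show ?thesis by simp
qed

lemma eventually_farey_card_ge:
  assumes "coeff P 0 = 0" "P \<noteq> 0" "b < beta_const P / 2"
  shows "\<forall>\<^sub>F Q in sequentially. b * (real Q)\<^sup>2 \<le> real (farey_card P Q)"
proof -
  define \<epsilon> where "\<epsilon> = (beta_const P / 2 - b) / 2"
  have \<epsilon>: "\<epsilon> > 0" using assms by (simp add: \<epsilon>_def)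
  obtain z where tail: "norm (sum (prime_root_density P) {m..<n}) < \<epsilon>" if "m \<ge> z" for m n
    using summable_prime_root_density[OF assms(2)] \<epsilon> unfolding summable_Cauchy by blast
  have "(\<lambda>Q. real (card (sieved_pairs P z Q)) / (real Q)\<^sup>2) \<longlonglongrightarrow>
      (\<Prod>p | prime p \<and> p \<le> z. 1 - root_density P p) / 2"
    by (rule tendsto_card_sieved_pairs)
  moreover have "b + \<epsilon> < (\<Prod>p | prime p \<and> p \<le> z. 1 - root_density P p) / 2"
    using beta_const_le_prod[OF assms(2), of z] \<epsilon> by (simp add: \<epsilon>_def field_simps)
  ultimately have "\<forall>\<^sub>F Q in sequentially. b + \<epsilon> < real (card (sieved_pairs P z Q)) / (real Q)\<^sup>2"
    by (rule order_tendstoD)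
  then show ?thesis using eventually_gt_at_top[of 0]
  proof eventually_elim
    case (elim Q)
    have "(b + \<epsilon>) * (real Q)\<^sup>2 \<le> real (card (sieved_pairs P z Q))"
      using elim by (simp add: pos_less_divide_eq)
    also have "\<dots> \<le> real (farey_card P Q) + (\<Sum>p\<in>{z<..Q}. prime_root_density P p) * (real Q)\<^sup>2"
      by (rule card_sieved_pairs_le_farey_card[OF assms(1)])
    also have "(\<Sum>p\<in>{z<..Q}. prime_root_density P p) \<le> \<epsilon>"
      using tail[of "Suc z" "Suc Q"]
      by (simp add: atLeastLessThanSuc_atLeastAtMost atLeastSucAtMost_greaterThanAtMost)
    finally show ?case by (simp add: distrib_right mult_right_mono)
  qed
qed

section \<open>Pairs of close fractions\<close>

lemma div_gcd_dvd_if_dvd_cross_difference: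
  fixes q r :: nat and x y :: int
  assumes "q > 0" "int q * int r dvd x * int r - y * int q"
  shows "int (q div gcd q r) dvd x"
proof -
  let ?g = "gcd q r"
  have "int q dvd x * int r"
    using dvd_add[OF dvd_mult_left[OF assms(2)], of "y * int q"] by simp
  then have "int ?g * int (q div ?g) dvd int ?g * (x * int (r div ?g))"
    by (simp add: mult.left_commute flip: of_nat_mult)
  then have "int (q div ?g) dvd x * int (r div ?g)"
    using assms(1) by (simp del: of_nat_mult)
  then show ?thesis
    using div_gcd_coprime[of q r] assms(1) by (simp add: coprime_dvd_mult_left_iff del: of_nat_div)
qed

text \<open>\<open>[a r - b q = k] (mod q r)\<close> says that \<open>a / q - b / r\<close> equals \<open>k / (q r)\<close> modulo 1.\<close>
definition difference_numerators :: "nat \<Rightarrow> nat \<Rightarrow> int \<Rightarrow> (nat \<times> nat) set" where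
  "difference_numerators q r k =
     {(a, b) \<in> {1..q} \<times> {1..r}. [int a * int r - int b * int q = k] (mod int q * int r)}"

lemma finite_difference_numerators [simp]: "finite (difference_numerators q r k)"
  by (rule finite_subset[of _ "{1..q} \<times> {1..r}"]) (auto simp: difference_numerators_def)

lemma card_difference_numerators_le_gcd:
  assumes "q > 0" "r > 0"
  shows "card (difference_numerators q r k) \<le> gcd q r"
proof (cases "difference_numerators q r k = {}")
  case True
  then show ?thesis by (simp only: card.empty)
next
  case False
  let ?D = "difference_numerators q r k"
  from False obtain c d where cd: "(c, d) \<in> ?D" by auto
  define s where "s = q div gcd q r"
  have q_eq: "q = gcd q r * s" by (simp add: s_def)
  have dvd_diff: "int q * int r dvd (int a - int a') * int r - (int b - int b') * int q"
    if "(a, b) \<in> ?D" "(a', b') \<in> ?D" for a b a' b'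
  proof -
    have "[int a * int r - int b * int q = int a' * int r - int b' * int q] (mod int q * int r)"
      using that by (auto simp: difference_numerators_def intro: cong_trans cong_sym)
    then show ?thesis by (simp add: cong_iff_dvd_diff algebra_simps)
  qed
  have "b = b'" if ab: "(a, b) \<in> ?D" "(a, b') \<in> ?D" for a b b'
  proof -
    have "int q * int r dvd int q * (int b' - int b)"
      using dvd_diff[OF ab] by (simp add: algebra_simps)
    then have "int r dvd int b' - int b" using assms(1) by simp
    moreover have "\<bar>int b' - int b\<bar> < int r" using ab by (auto simp: difference_numerators_def)
    ultimately show ?thesis using dvd_imp_le_int[of "int b' - int b" "int r"] by fastforce
  qed
  then have "inj_on fst ?D" by (intro inj_onI) auto
  moreover have "[a = c] (mod s)" if ab: "(a, b) \<in> ?D" for a b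
    using div_gcd_dvd_if_dvd_cross_difference[OF assms(1) dvd_diff[OF ab cd]]
    by (simp add: s_def cong_iff_dvd_diff del: of_nat_div flip: cong_int_iff)
  then have "fst ` ?D \<subseteq> {a \<in> {1..gcd q r * s}. [a = c] (mod s)}"
    unfolding q_eq[symmetric] by (auto simp: difference_numerators_def)
  ultimately have "card ?D \<le> card {a \<in> {1..gcd q r * s}. [a = c] (mod s)}"
    by (rule card_inj_on_le) simp
  also have "\<dots> \<le> gcd q r" by (rule card_residue_class_le)
  finally show ?thesis .
qed

lemma card_multiples_greaterThan_le:
  fixes x :: real
  assumes "g > 0" "x \<ge> 0"
  shows "real (card {q \<in> {1..Q}. x < real q \<and> g dvd q}) \<le> max 0 (real Q - x) / real g + 1"
proof -
  define n where "n = nat \<lfloor>x / real g\<rfloor>"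
  have n_less_iff: "n < j \<longleftrightarrow> x < real g * real j" for j
  proof -
    have "n < j \<longleftrightarrow> x / real g < real j"
      using assms by (simp add: n_def nat_less_iff floor_less_iff)
    then show ?thesis using assms(1) by (simp add: divide_less_eq mult.commute)
  qed
  have "{q \<in> {1..Q}. x < real q \<and> g dvd q} \<subseteq> (\<lambda>j. g * j) ` {n<..Q div g}"
    using assms(1) by (auto simp: n_less_iff less_eq_div_iff_mult_less_eq mult.commute)
  then have "card {q \<in> {1..Q}. x < real q \<and> g dvd q} \<le> card {n<..Q div g}"
    by (rule surj_card_le[rotated]) simp
  then have "real (card {q \<in> {1..Q}. x < real q \<and> g dvd q}) \<le> max 0 (real (Q div g) - real n)"
    by (simp flip: of_nat_diff_real)
  also have "\<dots> \<le> max 0 (real Q / real g - x / real g) + 1"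
  proof -
    have "x / real g < real n + 1"
      using n_less_iff[of "Suc n"] assms(1) by (simp add: divide_less_eq algebra_simps)
    then show ?thesis
      using of_nat_div_le_of_nat[of Q g, where 'a = real] by linarith
  qed
  also have "\<dots> = max 0 (real Q - x) / real g + 1"
    by (simp add: max_divide_distrib_right diff_divide_distrib)
  finally show ?thesis .
qed

definition mod1_gap_less :: "real \<Rightarrow> real \<Rightarrow> real \<Rightarrow> bool" where
  "mod1_gap_less w x y \<longleftrightarrow> (\<exists>j::int. 0 < x - y - of_int j \<and> x - y - of_int j < w)"

definition close_numerators :: "nat \<Rightarrow> nat \<Rightarrow> real \<Rightarrow> (nat \<times> nat) set" where
  "close_numerators q r w =
     {(a, b) \<in> {1..q} \<times> {1..r}. mod1_gap_less w (real a / real q) (real b / real r)}"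

lemma finite_close_numerators [simp]: "finite (close_numerators q r w)"
  by (rule finite_subset[of _ "{1..q} \<times> {1..r}"]) (auto simp: close_numerators_def)

lemma mod1_gap_less_fractionsE:
  assumes "mod1_gap_less w (real a / real q) (real b / real r)" "q > 0" "r > 0"
  obtains k :: nat where "k > 0" "real k < w * real q * real r" "gcd q r dvd k"
    "[int a * int r - int b * int q = int k] (mod int q * int r)"
proof -
  obtain j :: int where j: "0 < real a / real q - real b / real r - of_int j"
    "real a / real q - real b / real r - of_int j < w"
    using assms(1) by (auto simp: mod1_gap_less_def)
  define k where "k = int a * int r - int b * int q - j * (int q * int r)"
  have k_eq: "real_of_int k = (real a / real q - real b / real r - of_int j) * (real q * real r)"
    unfolding k_def using assms(2,3) by (simp add: field_simps)
  then have "real_of_int k > 0" using j(1) assms(2,3) by simp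
  then have k: "k > 0" "int (nat k) = k" by simp_all
  show thesis
  proof
    show "nat k > 0" using k by simp
    show "real (nat k) < w * real q * real r"
      using mult_strict_right_mono[OF j(2), of "real q * real r"] assms(2,3) k by (simp add: k_eq)
    have "int (gcd q r) dvd k"
      unfolding k_def by (intro dvd_diff dvd_mult dvd_mult2) auto
    then show "gcd q r dvd nat k" using k by (metis int_dvd_int_iff)
    show "[int a * int r - int b * int q = int (nat k)] (mod int q * int r)"
      unfolding k(2) by (simp add: k_def cong_iff_dvd_diff)
  qed
qed

lemma card_close_numerators_le:
  assumes "q > 0" "r > 0"
  shows "card (close_numerators q r w) \<le>
    gcd q r * card {k. 0 < k \<and> gcd q r dvd k \<and> real k < w * real q * real r}"
proof -
  let ?K = "{k. 0 < k \<and> gcd q r dvd k \<and> real k < w * real q * real r}"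
  let ?D = "\<lambda>k::nat. difference_numerators q r (int k)"
  have "k \<le> nat \<lceil>w * real q * real r\<rceil>" if "real k < w * real q * real r" for k
    using that by linarith
  then have "?K \<subseteq> {..nat \<lceil>w * real q * real r\<rceil>}" by auto
  then have finK: "finite ?K" by (rule finite_subset) simp
  have "close_numerators q r w \<subseteq> (\<Union>k\<in>?K. ?D k)"
  proof clarify
    fix a b
    assume "(a, b) \<in> close_numerators q r w"
    then have ab: "a \<in> {1..q}" "b \<in> {1..r}"
      and gap: "mod1_gap_less w (real a / real q) (real b / real r)"
      by (auto simp: close_numerators_def)
    from gap show "(a, b) \<in> (\<Union>k\<in>?K. ?D k)"
      using assms by (rule mod1_gap_less_fractionsE)
        (use ab in \<open>auto simp: difference_numerators_def\<close>)
  qed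
  then have "card (close_numerators q r w) \<le> card (\<Union>k\<in>?K. ?D k)"
    using finK by (intro card_mono) auto
  also have "\<dots> \<le> (\<Sum>k\<in>?K. card (?D k))" by (rule card_UN_le[OF finK])
  also have "\<dots> \<le> (\<Sum>k\<in>?K. gcd q r)"
    by (intro sum_mono card_difference_numerators_le_gcd assms)
  also have "\<dots> = gcd q r * card ?K" by simp
  finally show ?thesis .
qed

lemma sum_gcd_le_sum_divisors:
  assumes "finite A" "k > 0"
  shows "(\<Sum>(q, r) | q \<in> A \<and> r \<in> A \<and> gcd q r dvd k. gcd q r) \<le>
    (\<Sum>g | g dvd k. g * (card {q \<in> A. g dvd q})\<^sup>2)"
proof -
  let ?Z = "{(q, r). q \<in> A \<and> r \<in> A \<and> gcd q r dvd k}"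
  have "?Z \<subseteq> A \<times> A" by auto
  then have finZ: "finite ?Z" using assms(1) finite_subset by blast
  let ?gcd = "\<lambda>(q, r). gcd q r"
  have "sum ?gcd ?Z = (\<Sum>g | g dvd k. \<Sum>x | x \<in> ?Z \<and> ?gcd x = g. ?gcd x)"
    by (rule sum.group[symmetric]) (use finZ assms(2) in auto)
  also have "\<dots> = (\<Sum>g | g dvd k. g * card {x \<in> ?Z. ?gcd x = g})"
    by (intro sum.cong) simp_all
  also have "\<dots> \<le> (\<Sum>g | g dvd k. g * card ({q \<in> A. g dvd q} \<times> {q \<in> A. g dvd q}))"
    using assms(1) by (intro sum_mono mult_left_mono card_mono) auto
  also have "\<dots> = (\<Sum>g | g dvd k. g * (card {q \<in> A. g dvd q})\<^sup>2)"
    by (simp add: card_cartesian_product power2_eq_square)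
  finally show ?thesis by simp
qed

section \<open>Summation over the denominators\<close>

definition large_denominators :: "nat \<Rightarrow> real \<Rightarrow> nat \<Rightarrow> nat set" where
  "large_denominators Q T k = {q \<in> {1..Q}. real k * real Q / T < real q}"

lemma finite_large_denominators [simp]: "finite (large_denominators Q T k)"
  by (simp add: large_denominators_def)

lemma large_denominatorsI:
  assumes "T > 0" "q \<in> {1..Q}" "r \<in> {1..Q}" "real k < T / (real Q)\<^sup>2 * real q * real r"
  shows "q \<in> large_denominators Q T k" "r \<in> large_denominators Q T k"
proof -
  have large: "real k * real Q / T < real x"
    if "x \<in> {1..Q}" "y \<in> {1..Q}" "real k < T / (real Q)\<^sup>2 * real x * real y" for x y
  proof -
    note that(3)
    also have "T / (real Q)\<^sup>2 * real x * real y \<le> T / (real Q)\<^sup>2 * real x * real Q"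
      using that(2) assms(1) by (intro mult_left_mono) auto
    also have "\<dots> = T * real x / real Q" by (simp add: power2_eq_square)
    finally show ?thesis using that(1) assms(1) by (simp add: field_simps)
  qed
  show "q \<in> large_denominators Q T k" "r \<in> large_denominators Q T k"
    using large[of q r] large[of r q] assms by (simp_all add: large_denominators_def ac_simps)
qed

lemma large_denominators_imp_less:
  assumes "T > 0" "q \<in> large_denominators Q T k"
  shows "real k < T"
proof -
  have "real k * real Q / T < real Q" "Q > 0"
    using assms(2) by (auto simp: large_denominators_def)
  then show ?thesis using assms(1) by (simp add: field_simps)
qed

lemma card_multiples_large_denominators_le:
  assumes "Q > 0" "T > 0" "g > 0"
  shows "real (card {q \<in> large_denominators Q T k. g dvd q}) \<le>
    real Q * ((1 - min 1 (real k / T)) / real g + 1 / real Q)"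
proof -
  have "real (card {q \<in> large_denominators Q T k. g dvd q}) \<le>
      max 0 (real Q - real k * real Q / T) / real g + 1"
    unfolding large_denominators_def
    using card_multiples_greaterThan_le[of g "real k * real Q / T" Q] assms by simp
  also have "max 0 (real Q - real k * real Q / T) = real Q * (1 - min 1 (real k / T))"
    using assms by (auto simp: max_def min_def field_simps)
  finally show ?thesis using assms by (simp add: distrib_left)
qed

lemma sum_card_close_numerators_le_sum_divisors:
  assumes "T > 0" "T \<le> real K"
  shows "(\<Sum>(q, r)\<in>{1..Q} \<times> {1..Q}. card (close_numerators q r (T / (real Q)\<^sup>2))) \<le>
    (\<Sum>k=1..K. \<Sum>g | g dvd k. g * (card {q \<in> large_denominators Q T k. g dvd q})\<^sup>2)"
proof -
  let ?w = "T / (real Q)\<^sup>2" and ?R = "{1..Q} \<times> {1..Q}" and ?L = "large_denominators Q T"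
  let ?N = "\<lambda>q r. {k \<in> {1..K}. q \<in> ?L k \<and> r \<in> ?L k \<and> gcd q r dvd k}"
  have "(\<Sum>(q, r)\<in>?R. card (close_numerators q r ?w)) \<le> (\<Sum>(q, r)\<in>?R. \<Sum>k\<in>?N q r. gcd q r)"
  proof (rule sum_mono, clarify)
    fix q r
    assume qr: "q \<in> {1..Q}" "r \<in> {1..Q}"
    have "k \<in> {1..K} \<and> q \<in> ?L k \<and> r \<in> ?L k" if k: "0 < k" "real k < ?w * real q * real r" for k
      using large_denominatorsI[OF assms(1) qr k(2)] k(1) assms(2)
        large_denominators_imp_less[OF assms(1), of q Q k] by auto
    then have "card {k. 0 < k \<and> gcd q r dvd k \<and> real k < ?w * real q * real r} \<le> card (?N q r)"
      by (intro card_mono) auto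
    moreover have "card (close_numerators q r ?w) \<le>
        gcd q r * card {k. 0 < k \<and> gcd q r dvd k \<and> real k < ?w * real q * real r}"
      using qr by (intro card_close_numerators_le) auto
    ultimately have "card (close_numerators q r ?w) \<le> gcd q r * card (?N q r)"
      by (meson mult_le_mono2 order_trans)
    then show "card (close_numerators q r ?w) \<le> (\<Sum>k\<in>?N q r. gcd q r)"
      by (simp add: mult.commute)
  qed
  also have "\<dots> = (\<Sum>k=1..K. \<Sum>(q, r) | (q, r) \<in> ?R \<and> q \<in> ?L k \<and> r \<in> ?L k \<and> gcd q r dvd k. gcd q r)"
    unfolding case_prod_unfold by (subst sum.swap_restrict) simp_all
  also have "\<dots> = (\<Sum>k=1..K. \<Sum>(q, r) | q \<in> ?L k \<and> r \<in> ?L k \<and> gcd q r dvd k. gcd q r)"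
    by (intro sum.cong) (auto simp: large_denominators_def)
  also have "\<dots> \<le> (\<Sum>k=1..K. \<Sum>g | g dvd k. g * (card {q \<in> ?L k. g dvd q})\<^sup>2)"
    by (rule sum_mono, rule sum_gcd_le_sum_divisors) auto
  finally show ?thesis .
qed

text \<open>
  The terms with \<open>k \<ge> T\<close> only contribute at the order of \<open>e\<^sup>2\<close>. Summing up to a cut-off that does
  not depend on \<open>T\<close> makes the bound continuous in \<open>T\<close>.
\<close>
definition close_pair_bound :: "nat \<Rightarrow> real \<Rightarrow> real \<Rightarrow> real" where
  "close_pair_bound K T e =
     (\<Sum>k=1..K. \<Sum>g | g dvd k. real g * ((1 - min 1 (real k / T)) / real g + e)\<^sup>2)"

lemma close_pair_bound_nonneg: "close_pair_bound K T e \<ge> 0"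
  by (simp add: close_pair_bound_def sum_nonneg)

lemma sum_card_close_numerators_le:
  assumes "Q > 0" "T > 0" "T \<le> real K"
  shows "real (\<Sum>(q, r)\<in>{1..Q} \<times> {1..Q}. card (close_numerators q r (T / (real Q)\<^sup>2))) \<le>
    (real Q)\<^sup>2 * close_pair_bound K T (1 / real Q)"
proof -
  have "real (\<Sum>(q, r)\<in>{1..Q} \<times> {1..Q}. card (close_numerators q r (T / (real Q)\<^sup>2))) \<le>
      real (\<Sum>k=1..K. \<Sum>g | g dvd k. g * (card {q \<in> large_denominators Q T k. g dvd q})\<^sup>2)"
    by (rule of_nat_mono[OF sum_card_close_numerators_le_sum_divisors[OF assms(2,3)]])
  also have "\<dots> = (\<Sum>k=1..K. \<Sum>g | g dvd k.
      real g * (real (card {q \<in> large_denominators Q T k. g dvd q}))\<^sup>2)"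
    by (simp only: of_nat_sum of_nat_mult of_nat_power)
  also have "\<dots> \<le> (\<Sum>k=1..K. \<Sum>g | g dvd k.
      real g * (real Q * ((1 - min 1 (real k / T)) / real g + 1 / real Q))\<^sup>2)"
    using assms(1,2)
    by (intro sum_mono mult_left_mono power_mono card_multiples_large_denominators_le)
      (auto intro: dvd_pos_nat)
  also have "\<dots> = (real Q)\<^sup>2 * close_pair_bound K T (1 / real Q)"
    unfolding close_pair_bound_def sum_distrib_left power_mult_distrib
    by (simp only: mult.left_commute)
  finally show ?thesis .
qed

section \<open>The limit superior of the pair correlation\<close>

lemma card_close_farey_pairs_le:
  "card {(x, y) \<in> farey_set P Q \<times> farey_set P Q. mod1_gap_less w x y} \<le>
    (\<Sum>(q, r)\<in>{1..Q} \<times> {1..Q}. card (close_numerators q r w))"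
proof -
  let ?f = "\<lambda>((q, r), (a, b)). (real a / real q, real b / real r)"
  let ?S = "SIGMA (q, r):{1..Q} \<times> {1..Q}. close_numerators q r w"
  have "{(x, y) \<in> farey_set P Q \<times> farey_set P Q. mod1_gap_less w x y} \<subseteq> ?f ` ?S"
  proof clarify
    fix x y
    assume xy: "x \<in> farey_set P Q" "y \<in> farey_set P Q" "mod1_gap_less w x y"
    obtain a q b r where "x = real a / real q" "1 \<le> a" "a \<le> q" "q \<le> Q"
      and "y = real b / real r" "1 \<le> b" "b \<le> r" "r \<le> Q"
      using xy(1,2) by (auto simp: farey_set_def)
    then show "(x, y) \<in> ?f ` ?S"
      using xy(3) by (intro image_eqI[of _ _ "((q, r), (a, b))"]) (auto simp: close_numerators_def)
  qed
  then have "card {(x, y) \<in> farey_set P Q \<times> farey_set P Q. mod1_gap_less w x y} \<le> card ?S"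
    by (intro surj_card_le) auto
  also have "\<dots> = (\<Sum>(q, r)\<in>{1..Q} \<times> {1..Q}. card (close_numerators q r w))"
    by (subst card_SigmaI) (auto intro: sum.cong)
  finally show ?thesis .
qed

lemma pair_correlation_le:
  assumes "Q > 0" "\<Lambda> > 0" "T > 0" "T \<le> real K" "\<Lambda> * (real Q)\<^sup>2 \<le> T * real (farey_card P Q)"
  shows "pair_correlation P Q \<Lambda> \<le> T / \<Lambda> * close_pair_bound K T (1 / real Q)"
proof -
  define N where "N = real (farey_card P Q)"
  define X where "X = {(x, y) \<in> farey_set P Q \<times> farey_set P Q. mod1_gap_less (T / (real Q)\<^sup>2) x y}"
  have N_ge: "\<Lambda> * (real Q)\<^sup>2 \<le> T * N" using assms(5) by (simp add: N_def)
  moreover have "\<Lambda> * (real Q)\<^sup>2 > 0" using assms(1,2) by simp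
  ultimately have N: "N > 0" using assms(3) by (metis less_le_trans zero_less_mult_pos)
  let ?Y = "{(x, y). x \<in> farey_set P Q \<and> y \<in> farey_set P Q \<and> x \<noteq> y \<and>
      (\<exists>t\<in>{0<..<\<Lambda>}. \<exists>k::int. x - y = 1 / N * t + of_int k)}"
  have "?Y \<subseteq> X"
  proof clarify
    fix x y t and k :: int
    assume xy: "x \<in> farey_set P Q" "y \<in> farey_set P Q"
      and t: "t \<in> {0<..<\<Lambda>}" "x - y = 1 / N * t + of_int k"
    have "t / N < \<Lambda> / N" using t(1) N by (simp add: divide_strict_right_mono)
    also have "\<dots> \<le> T / (real Q)\<^sup>2" using N N_ge assms(1) by (simp add: field_simps)
    finally have "mod1_gap_less (T / (real Q)\<^sup>2) x y"
      using t N unfolding mod1_gap_less_def by (intro exI[of _ k]) simp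
    then show "(x, y) \<in> X" using xy by (simp add: X_def)
  qed
  moreover have "finite X"
    by (rule finite_subset[of _ "farey_set P Q \<times> farey_set P Q"]) (auto simp: X_def)
  ultimately have "real (card ?Y) \<le> real (card X)"
    by (simp add: card_mono)
  also have "\<dots> \<le> (real Q)\<^sup>2 * close_pair_bound K T (1 / real Q)"
    unfolding X_def using card_close_farey_pairs_le sum_card_close_numerators_le[OF assms(1,3,4)]
    by (meson of_nat_mono order_trans)
  also have "\<dots> \<le> N * (T / \<Lambda>) * close_pair_bound K T (1 / real Q)"
    using N_ge assms(2) by (intro mult_right_mono close_pair_bound_nonneg) (simp_all add: field_simps)
  finally show ?thesis
    unfolding pair_correlation_def N_def[symmetric] using N by (simp add: divide_le_eq ac_simps)
qed

lemma limsup_pair_correlation_le_of_greater: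
  assumes "coeff P 0 = 0" "P \<noteq> 0" "\<Lambda> > 0" "2 * \<Lambda> / beta_const P < T" "T \<le> real K"
  shows "limsup (\<lambda>Q. ereal (pair_correlation P Q \<Lambda>)) \<le> ereal (T / \<Lambda> * close_pair_bound K T 0)"
proof -
  have \<beta>: "beta_const P > 0" by (rule beta_const_pos[OF assms(2)])
  then have "2 * \<Lambda> / beta_const P > 0" using assms(3) by simp
  then have T: "T > 0" using assms(4) by linarith
  have "\<Lambda> / T < beta_const P / 2"
    using assms(4) \<beta> T by (simp add: field_simps)
  then have "\<forall>\<^sub>F Q in sequentially. \<Lambda> / T * (real Q)\<^sup>2 \<le> real (farey_card P Q)"
    by (rule eventually_farey_card_ge[OF assms(1,2)])
  then have "\<forall>\<^sub>F Q in sequentially.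
      ereal (pair_correlation P Q \<Lambda>) \<le> ereal (T / \<Lambda> * close_pair_bound K T (1 / real Q))"
    using eventually_gt_at_top[of 0]
  proof eventually_elim
    case (elim Q)
    then have "\<Lambda> * (real Q)\<^sup>2 \<le> T * real (farey_card P Q)"
      using T by (simp add: field_simps)
    then show ?case using pair_correlation_le[OF elim(2) assms(3) T assms(5)] by simp
  qed
  then have "limsup (\<lambda>Q. ereal (pair_correlation P Q \<Lambda>)) \<le>
      limsup (\<lambda>Q. ereal (T / \<Lambda> * close_pair_bound K T (1 / real Q)))"
    by (rule Limsup_mono)
  moreover have "(\<lambda>Q. T / \<Lambda> * close_pair_bound K T (1 / real Q)) \<longlonglongrightarrow> T / \<Lambda> * close_pair_bound K T 0"
    unfolding close_pair_bound_def by (intro tendsto_intros lim_1_over_n)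
  then have "limsup (\<lambda>Q. ereal (T / \<Lambda> * close_pair_bound K T (1 / real Q))) =
      ereal (T / \<Lambda> * close_pair_bound K T 0)"
    by (intro lim_imp_Limsup tendsto_ereal) simp_all
  ultimately show ?thesis by simp
qed

lemma limsup_pair_correlation_le:
  assumes "coeff P 0 = 0" "P \<noteq> 0" "\<Lambda> > 0" "2 * \<Lambda> / beta_const P < real K"
  shows "limsup (\<lambda>Q. ereal (pair_correlation P Q \<Lambda>)) \<le>
    ereal (2 / beta_const P * close_pair_bound K (2 * \<Lambda> / beta_const P) 0)"
proof -
  define U where "U = 2 * \<Lambda> / beta_const P"
  have U: "U > 0" using assms(3) beta_const_pos[OF assms(2)] by (simp add: U_def)
  have "((\<lambda>T. T / \<Lambda> * close_pair_bound K T 0) \<longlongrightarrow> U / \<Lambda> * close_pair_bound K U 0) (at_right U)"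
    unfolding close_pair_bound_def using U assms(3) by (intro tendsto_intros) auto
  then have "((\<lambda>T. ereal (T / \<Lambda> * close_pair_bound K T 0)) \<longlongrightarrow>
      ereal (U / \<Lambda> * close_pair_bound K U 0)) (at_right U)"
    by (rule tendsto_ereal)
  moreover have "\<forall>\<^sub>F T in at_right U.
      limsup (\<lambda>Q. ereal (pair_correlation P Q \<Lambda>)) \<le> ereal (T / \<Lambda> * close_pair_bound K T 0)"
    using assms(4)
    by (intro eventually_at_rightI[of U "real K"]
        limsup_pair_correlation_le_of_greater[OF assms(1-3)])
      (auto simp: U_def)
  ultimately have "limsup (\<lambda>Q. ereal (pair_correlation P Q \<Lambda>)) \<le>
      ereal (U / \<Lambda> * close_pair_bound K U 0)"
    by (rule tendsto_lowerbound) simp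
  then show ?thesis using assms(3) by (simp add: U_def)
qed

section \<open>The integral\<close>

definition area_under_neg_ln :: "real \<Rightarrow> real" where
  "area_under_neg_ln y = 1 - y + y * ln y"

lemma half_square_le_area_under_neg_ln:
  assumes "0 < y" "y \<le> 1"
  shows "(1 - y)\<^sup>2 / 2 \<le> area_under_neg_ln y"
proof -
  let ?f = "\<lambda>y. area_under_neg_ln y - (1 - y)\<^sup>2 / 2"
  have "?f 1 \<le> ?f y"
  proof (rule DERIV_nonpos_imp_nonincreasing[OF assms(2)])
    fix x assume "y \<le> x" "x \<le> 1"
    then have "x > 0" using assms by simp
    then have "(?f has_real_derivative ln x + 1 - x) (at x)"
      unfolding area_under_neg_ln_def by (auto intro!: derivative_eq_intros simp: field_simps)
    moreover have "ln x + 1 - x \<le> 0" using ln_le_minus_one[OF \<open>x > 0\<close>] by simp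
    ultimately show "\<exists>d. (?f has_real_derivative d) (at x) \<and> d \<le> 0" by blast
  qed
  then show ?thesis by (simp add: area_under_neg_ln_def)
qed

lemma has_integral_ln_over_square:
  fixes c \<Lambda> :: real
  assumes "c > 0" "c \<le> \<Lambda>"
  shows "((\<lambda>t. ln (t / c) / t\<^sup>2) has_integral area_under_neg_ln (c / \<Lambda>) / c) {c..\<Lambda>}"
proof -
  let ?F = "\<lambda>t. - (1 + ln (t / c)) / t"
  have "(?F has_vector_derivative ln (t / c) / t\<^sup>2) (at t within {c..\<Lambda>})" if "t \<in> {c..\<Lambda>}" for t
  proof -
    have "(?F has_real_derivative ln (t / c) / t\<^sup>2) (at t)"
      using assms that by (auto intro!: derivative_eq_intros simp: field_simps power2_eq_square)
    then show ?thesis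
      using has_real_derivative_iff_has_vector_derivative has_vector_derivative_at_within by blast
  qed
  then have "((\<lambda>t. ln (t / c) / t\<^sup>2) has_integral ?F \<Lambda> - ?F c) {c..\<Lambda>}"
    by (rule fundamental_theorem_of_calculus[OF assms(2)])
  moreover have "?F \<Lambda> - ?F c = area_under_neg_ln (c / \<Lambda>) / c"
    using assms by (simp add: area_under_neg_ln_def ln_div field_simps)
  ultimately show ?thesis by simp
qed

lemma has_integral_truncated_ln_over_square:
  fixes c \<Lambda> :: real
  assumes "c > 0" "\<Lambda> > 0"
  shows "((\<lambda>t. if c < t then ln (t / c) / t\<^sup>2 else 0) has_integral
    area_under_neg_ln (min 1 (c / \<Lambda>)) / c) {0..\<Lambda>}"
proof (cases "c < \<Lambda>")
  case True
  let ?f = "\<lambda>t. if c < t then ln (t / c) / t\<^sup>2 else 0"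
  have "(?f has_integral area_under_neg_ln (c / \<Lambda>) / c) {c..\<Lambda>}"
    using has_integral_ln_over_square[OF assms(1) less_imp_le[OF True]]
    by (rule has_integral_eq[rotated]) (use assms in auto)
  moreover have "(?f has_integral 0) {0..c}"
    by (rule has_integral_is_0) auto
  ultimately have "(?f has_integral (0 + area_under_neg_ln (c / \<Lambda>) / c)) {0..\<Lambda>}"
    using True assms by (intro has_integral_combine[of 0 c]) auto
  then show ?thesis using True assms by (simp add: min_def)
next
  case False
  have "((\<lambda>t. if c < t then ln (t / c) / t\<^sup>2 else 0) has_integral 0) {0..\<Lambda>}"
    by (rule has_integral_is_0) (use False in auto)
  moreover have "min 1 (c / \<Lambda>) = 1" using False assms by simp
  ultimately show ?thesis by (simp add: area_under_neg_ln_def)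
qed

lemma integral_ln_sum_over_square:
  fixes h :: "nat \<Rightarrow> real"
  assumes "\<beta> > 0" "\<Lambda> > 0" "2 * \<Lambda> / \<beta> \<le> real K"
  shows "integral {0..\<Lambda>}
      (\<lambda>t. 1 / t\<^sup>2 * (\<Sum>m | 1 \<le> m \<and> real m < 2 * t / \<beta>. h m * ln (2 * t / (real m * \<beta>)))) =
    (\<Sum>m=1..K. h m * (area_under_neg_ln (min 1 (real m / (2 * \<Lambda> / \<beta>))) / (real m * \<beta> / 2)))"
proof -
  let ?f = "\<lambda>t. 1 / t\<^sup>2 * (\<Sum>m | 1 \<le> m \<and> real m < 2 * t / \<beta>. h m * ln (2 * t / (real m * \<beta>)))"
  let ?c = "\<lambda>m. real m * \<beta> / 2"
  let ?g = "\<lambda>t. \<Sum>m=1..K. h m * (if ?c m < t then ln (t / ?c m) / t\<^sup>2 else 0)"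
  let ?I = "\<Sum>m=1..K. h m * (area_under_neg_ln (min 1 (?c m / \<Lambda>)) / ?c m)"
  have "?g t = ?f t" if "t \<in> {0..\<Lambda>}" for t
  proof -
    have less_iff: "real m < 2 * t / \<beta> \<longleftrightarrow> ?c m < t" for m using assms by (simp add: field_simps)
    have "2 * t / \<beta> \<le> 2 * \<Lambda> / \<beta>" using that assms by (intro divide_right_mono) auto
    then have "m \<le> K" if "?c m < t" for m
      using that less_iff[of m] assms(3) by linarith
    then have "?g t = (\<Sum>m | 1 \<le> m \<and> real m < 2 * t / \<beta>. h m * (ln (t / ?c m) / t\<^sup>2))"
      by (intro sum.mono_neutral_cong_right) (auto simp: less_iff)
    also have "\<dots> = ?f t"
      unfolding sum_distrib_left by (rule sum.cong) (auto simp: mult.commute)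
    finally show ?thesis .
  qed
  moreover have "(?g has_integral ?I) {0..\<Lambda>}"
    using assms
    by (intro has_integral_sum has_integral_mult_right has_integral_truncated_ln_over_square) auto
  ultimately have "(?f has_integral ?I) {0..\<Lambda>}"
    by (rule has_integral_eq)
  then show ?thesis by (simp add: integral_unique mult.commute)
qed

lemma sum_inverse_divisors:
  fixes m :: nat
  assumes "m > 0"
  shows "(\<Sum>g | g dvd m. 1 / real g) = real (\<Sum>{d. d dvd m}) / real m"
proof -
  have "(\<Sum>g | g dvd m. 1 / real g) = (\<Sum>d | d dvd m. real d / real m)"
    by (rule sum.reindex_bij_witness[of _ "\<lambda>d. m div d" "\<lambda>g. m div g"])
      (use assms in \<open>auto simp: real_of_nat_div\<close>)
  then show ?thesis by (simp add: sum_divide_distrib)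
qed

lemma sum_divisors_le_h_weight:
  assumes "m > 0"
  shows "\<Sum>{d. d dvd m} \<le> h_weight P m"
proof -
  let ?H = "{(n, \<delta>, d\<^sub>1, d\<^sub>2). n \<ge> 1 \<and> \<delta> \<ge> 1 \<and> d\<^sub>1 \<ge> 1 \<and> d\<^sub>2 \<ge> (1::nat) \<and> n * \<delta> * d\<^sub>1 * d\<^sub>2 = m}"
  let ?w = "\<lambda>(n, \<delta>, d\<^sub>1, d\<^sub>2). n * root_count P d\<^sub>1 * root_count P d\<^sub>2"
  let ?i = "\<lambda>d. (d, m div d, 1::nat, 1::nat)"
  have "?H \<subseteq> {d. d dvd m} \<times> {d. d dvd m} \<times> {d. d dvd m} \<times> {d. d dvd m}"
    by auto
  then have "finite ?H" using assms by (auto elim: finite_subset)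
  moreover have "?i ` {d. d dvd m} \<subseteq> ?H"
    using assms by (auto simp: Suc_le_eq div_greater_zero_iff dvd_imp_le intro: dvd_pos_nat)
  ultimately have "sum ?w (?i ` {d. d dvd m}) \<le> h_weight P m"
    unfolding h_weight_def by (intro sum_mono2) auto
  moreover have "sum ?w (?i ` {d. d dvd m}) = \<Sum>{d. d dvd m}"
    by (subst sum.reindex) (auto intro: inj_onI)
  ultimately show ?thesis by simp
qed

lemma close_pair_bound_0:
  "close_pair_bound K T 0 =
    (\<Sum>k=1..K. (1 - min 1 (real k / T))\<^sup>2 * (real (\<Sum>{d. d dvd k}) / real k))"
  unfolding close_pair_bound_def
proof (rule sum.cong[OF refl])
  fix k
  assume "k \<in> {1..K}"
  have "(\<Sum>g | g dvd k. real g * ((1 - min 1 (real k / T)) / real g + 0)\<^sup>2) =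
      (1 - min 1 (real k / T))\<^sup>2 * (\<Sum>g | g dvd k. 1 / real g)"
    unfolding sum_distrib_left by (rule sum.cong) (simp_all add: power2_eq_square)
  then show "(\<Sum>g | g dvd k. real g * ((1 - min 1 (real k / T)) / real g + 0)\<^sup>2) =
      (1 - min 1 (real k / T))\<^sup>2 * (real (\<Sum>{d. d dvd k}) / real k)"
    using \<open>k \<in> {1..K}\<close> by (simp add: sum_inverse_divisors)
qed

lemma close_pair_bound_le_integral:
  assumes "\<beta> > 0" "\<Lambda> > 0" "2 * \<Lambda> / \<beta> \<le> real K"
  shows "2 / \<beta> * close_pair_bound K (2 * \<Lambda> / \<beta>) 0 \<le>
    2 * integral {0..\<Lambda>} (\<lambda>t. 1 / t\<^sup>2 * (\<Sum>m | 1 \<le> m \<and> real m < 2 * t / \<beta>.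
      real (h_weight P m) * ln (2 * t / (real m * \<beta>))))"
  unfolding close_pair_bound_0 integral_ln_sum_over_square[OF assms]
    sum_distrib_left[of _ _ "{1..K}"]
proof (rule sum_mono)
  fix m
  assume "m \<in> {1..K}"
  then have m: "m > 0" by simp
  define y where "y = min 1 (real m / (2 * \<Lambda> / \<beta>))"
  have "(1 - y)\<^sup>2 \<le> 2 * area_under_neg_ln y"
    using half_square_le_area_under_neg_ln[of y] m assms(1,2) by (simp add: y_def)
  then have "(1 - y)\<^sup>2 * (real (\<Sum>{d. d dvd m}) / real m) \<le>
      2 * area_under_neg_ln y * (real (h_weight P m) / real m)"
    by (intro mult_mono' divide_right_mono of_nat_mono sum_divisors_le_h_weight m)
      (simp_all del: of_nat_sum)
  then have "2 / \<beta> * ((1 - y)\<^sup>2 * (real (\<Sum>{d. d dvd m}) / real m)) \<le>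
      2 / \<beta> * (2 * area_under_neg_ln y * (real (h_weight P m) / real m))"
    using assms(1) by (intro mult_left_mono) simp_all
  then show "2 / \<beta> * ((1 - min 1 (real m / (2 * \<Lambda> / \<beta>)))\<^sup>2 * (real (\<Sum>{d. d dvd m}) / real m)) \<le>
      2 * (real (h_weight P m) *
        (area_under_neg_ln (min 1 (real m / (2 * \<Lambda> / \<beta>))) / (real m * \<beta> / 2)))"
    unfolding y_def[symmetric] by (simp add: ac_simps)
qed

theorem theorem1p3:
  shows "\<exists>C::real. C > 0 \<and>
    (\<forall>(\<nu>::nat) (P::int poly).
       \<nu> \<ge> 2 \<and> degree P = \<nu> \<and> coeff P 0 = 0 \<and> discriminant P \<noteq> 0 \<longrightarrow>
       (\<forall>\<Lambda>::real. \<Lambda> > 0 \<longrightarrow>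
          \<bar>limsup (\<lambda>Q. ereal (pair_correlation P Q \<Lambda>))\<bar> \<noteq> \<infinity> \<and>
          limsup (\<lambda>Q. ereal (pair_correlation P Q \<Lambda>)) \<le>
            ereal (C * integral {0..\<Lambda>} (\<lambda>t. 1 / t\<^sup>2 *
              (\<Sum>m | 1 \<le> m \<and> real m < 2 * t / beta_const P.
                 real (h_weight P m) * ln (2 * t / (real m * beta_const P)))))))"
proof (intro exI[of _ 2] conjI allI impI)
  fix \<nu> :: nat and P :: "int poly" and \<Lambda> :: real
  assume "\<nu> \<ge> 2 \<and> degree P = \<nu> \<and> coeff P 0 = 0 \<and> discriminant P \<noteq> 0" and \<Lambda>: "\<Lambda> > 0"
  then have P: "coeff P 0 = 0" "P \<noteq> 0" by auto
  obtain K where K: "2 * \<Lambda> / beta_const P < real K" using reals_Archimedean2 by blast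
  show upper: "limsup (\<lambda>Q. ereal (pair_correlation P Q \<Lambda>)) \<le>
      ereal (2 * integral {0..\<Lambda>} (\<lambda>t. 1 / t\<^sup>2 * (\<Sum>m | 1 \<le> m \<and> real m < 2 * t / beta_const P.
        real (h_weight P m) * ln (2 * t / (real m * beta_const P)))))"
    using limsup_pair_correlation_le[OF P \<Lambda> K]
      close_pair_bound_le_integral[OF beta_const_pos[OF P(2)] \<Lambda> less_imp_le[OF K], of P]
    by (meson ereal_less_eq(3) order_trans)
  have "0 \<le> limsup (\<lambda>Q. ereal (pair_correlation P Q \<Lambda>))"
    by (rule le_Limsup) (auto simp: pair_correlation_def)
  then show "\<bar>limsup (\<lambda>Q. ereal (pair_correlation P Q \<Lambda>))\<bar> \<noteq> \<infinity>"
    using upper by (cases "limsup (\<lambda>Q. ereal (pair_correlation P Q \<Lambda>))") auto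
qed simp

end
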